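(* Let $\mathcal{C}\subset\mathbb{R}^n$ be $\alpha$-prox-regular for some $\alpha>0$, let $x\in\mathcal{C}+\frac{1}{2\alpha}\operatorname{int}\mathbb{B}$ and $v\in\mathbb{R}^n$, and assume that the directional derivative $\overline{v}:=DP_{\mathcal{C}}(x;v)$ exists. Then $\langle\overline{v},\,x-P_{\mathcal{C}}(x)\rangle=0$.
   Context: $\mathbb{R}^n$ carries the usual inner product and 2-norm; $\operatorname{int}\mathbb{B}$ is the open unit ball. $P_{\mathcal{C}}(x)$ is the set of points of $\mathcal{C}$ at minimal Euclidean distance from $x$. $T_x\mathcal{C}$ is the (Bouligand) tangent cone of $\mathcal{C}$ at $x\in\mathcal{C}$. $\mathcal{C}$ is Clarke regular if it is closed and $x\mapsto T_x\mathcal{C}$ is inner semicontinuous; then $N_x\mathcal{C}$ denotes the normal cone, i.e., the polar cone of $T_x\mathcal{C}$. Given $\alpha>0$, a Clarke regular set $\mathcal{C}$ is $\alpha$-prox-regular if for every $x\in\mathcal{C}$ and every $\eta\in N_x\mathcal{C}$ one has $\langle\eta,y-x\rangle\le\alpha\|\eta\|\|y-x\|^2$ for all $y\in\mathcal{C}$. It is known that then $P_{\mathcal{C}}$ is single-valued on the open set $\mathcal{C}+\frac{1}{2\alpha}\operatorname{int}\mathbb{B}$. The directional derivative is $DP_{\mathcal{C}}(x;v):=\lim_{h\to0^+}\frac{P_{\mathcal{C}}(x+hv)-P_{\mathcal{C}}(x)}{h}$. *)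

theory Defs
  imports "HOL-Analysis.Analysis"
begin

definition tangent_cone :: "'a::euclidean_space set \<Rightarrow> 'a \<Rightarrow> 'a set" where
  "tangent_cone C x =
     {v. \<exists>y t. (\<forall>k. y k \<in> C) \<and> (\<forall>k. 0 < t k) \<and>
           y \<longlonglongrightarrow> x \<and> t \<longlonglongrightarrow> (0::real) \<and>
           (\<lambda>k. (1 / t k) *\<^sub>R (y k - x)) \<longlonglongrightarrow> v}"

text \<open>Sequential form of \<open>F x \<subseteq> liminf F y\<close> as \<open>y\<close> tends to \<open>x\<close> within \<open>S\<close>.\<close>

definition inner_semicontinuous_on ::
    "'a::topological_space set \<Rightarrow> ('a \<Rightarrow> 'b::topological_space set) \<Rightarrow> bool" where
  "inner_semicontinuous_on S F \<longleftrightarrow>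
     (\<forall>x\<in>S. \<forall>v\<in>F x. \<forall>y. (\<forall>k. y k \<in> S) \<and> y \<longlonglongrightarrow> x \<longrightarrow>
        (\<exists>w. (\<forall>k::nat. w k \<in> F (y k)) \<and> w \<longlonglongrightarrow> v))"

definition clarke_regular :: "'a::euclidean_space set \<Rightarrow> bool" where
  "clarke_regular C \<longleftrightarrow> closed C \<and> inner_semicontinuous_on C (tangent_cone C)"

definition polar_cone :: "'a::real_inner set \<Rightarrow> 'a set" where
  "polar_cone K = {\<eta>. \<forall>v\<in>K. \<eta> \<bullet> v \<le> 0}"

definition normal_cone :: "'a::euclidean_space set \<Rightarrow> 'a \<Rightarrow> 'a set" where
  "normal_cone C x = polar_cone (tangent_cone C x)"

definition prox_regular :: "real \<Rightarrow> 'a::euclidean_space set \<Rightarrow> bool" where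
  "prox_regular \<alpha> C \<longleftrightarrow>
     clarke_regular C \<and>
     (\<forall>x\<in>C. \<forall>\<eta>\<in>normal_cone C x. \<forall>y\<in>C. \<eta> \<bullet> (y - x) \<le> \<alpha> * norm \<eta> * (norm (y - x))\<^sup>2)"

definition has_dir_derivative ::
    "('a::real_normed_vector \<Rightarrow> 'b::real_normed_vector) \<Rightarrow> 'a \<Rightarrow> 'a \<Rightarrow> 'b \<Rightarrow> bool" where
  "has_dir_derivative f x v d \<longleftrightarrow>
     ((\<lambda>h. (1 / h) *\<^sub>R (f (x + h *\<^sub>R v) - f x)) \<longlongrightarrow> d) (at_right (0::real))"

lemma nearest_point_normal:
  assumes p: "p \<in> C" and min: "\<And>y. y \<in> C \<Longrightarrow> dist x p \<le> dist x y"
  shows "x - p \<in> normal_cone C p"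
  unfolding normal_cone_def polar_cone_def
proof (clarify)
  fix v assume "v \<in> tangent_cone C p"
  then obtain y t where y: "\<And>k. y k \<in> C" and t: "\<And>k. 0 < t k"
    and lim: "y \<longlonglongrightarrow> p" "(\<lambda>k. (1 / t k) *\<^sub>R (y k - p)) \<longlonglongrightarrow> v"
    unfolding tangent_cone_def by blast
  have key: "2 * ((x - p) \<bullet> ((1 / t k) *\<^sub>R (y k - p))) \<le> (y k - p) \<bullet> ((1 / t k) *\<^sub>R (y k - p))" for k
  proof -
    have "(norm (x - p))\<^sup>2 \<le> (norm (x - y k))\<^sup>2"
      using min[OF y[of k]] by (intro power_mono) (auto simp: dist_norm)
    hence "2 * ((x - p) \<bullet> (y k - p)) \<le> (y k - p) \<bullet> (y k - p)"
      by (simp add: power2_norm_eq_inner inner_diff inner_commute)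
    thus ?thesis
      using t[of k] by (simp add: divide_right_mono)
  qed
  have "(\<lambda>k. 2 * ((x - p) \<bullet> ((1 / t k) *\<^sub>R (y k - p)))) \<longlonglongrightarrow> 2 * ((x - p) \<bullet> v)"
    by (intro tendsto_intros lim)
  moreover have "(\<lambda>k. (y k - p) \<bullet> ((1 / t k) *\<^sub>R (y k - p))) \<longlonglongrightarrow> (p - p) \<bullet> v"
    by (intro tendsto_intros lim)
  ultimately have "2 * ((x - p) \<bullet> v) \<le> (p - p) \<bullet> v"
    by (rule LIMSEQ_le) (use key in blast)
  thus "(x - p) \<bullet> v \<le> 0" by simp
qed

text \<open>The library's \<^const>\<open>closest_point\<close> is a choice of a nearest point. On the tube around a
  prox-regular set the set of nearest points is a singleton, so that \<^const>\<open>closest_point\<close> is the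
  metric projection there.\<close>

lemma nearest_points_eq_closest_point:
  fixes C :: "'a::euclidean_space set"
  assumes C: "prox_regular \<alpha> C" and \<alpha>: "\<alpha> > 0"
    and x: "x \<in> {c + (1 / (2 * \<alpha>)) *\<^sub>R b | c b. c \<in> C \<and> b \<in> ball 0 1}"
  shows "{p \<in> C. \<forall>y\<in>C. dist x p \<le> dist x y} = {closest_point C x}"
proof -
  have cl: "closed C" using C by (simp add: prox_regular_def clarke_regular_def)
  obtain c b where cb: "c \<in> C" "norm b < 1" "x = c + (1 / (2 * \<alpha>)) *\<^sub>R b"
    using x by auto
  have dc: "dist x c < 1 / (2 * \<alpha>)"
    using cb \<alpha> by (simp add: dist_norm divide_simps)
  let ?q = "closest_point C x"
  have q: "?q \<in> C" "\<And>y. y \<in> C \<Longrightarrow> dist x ?q \<le> dist x y"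
    using closest_point_exists[OF cl, of x] cb(1) by auto
  have "p = ?q" if p: "p \<in> C" "\<forall>y\<in>C. dist x p \<le> dist x y" for p
  proof (rule ccontr)
    assume ne: "p \<noteq> ?q"
    have r: "norm (x - p) < 1 / (2 * \<alpha>)"
      using p(2) cb(1) dc by (force simp: dist_norm)
    have "dist x p = dist x ?q" using p q by (meson antisym)
    hence "(norm (x - p))\<^sup>2 = (norm (x - ?q))\<^sup>2" by (simp add: dist_norm)
    hence eq: "2 * ((x - p) \<bullet> (?q - p)) = (norm (?q - p))\<^sup>2"
      by (simp add: power2_norm_eq_inner inner_diff inner_commute)
    have "x - p \<in> normal_cone C p" using p by (intro nearest_point_normal) auto
    hence "(x - p) \<bullet> (?q - p) \<le> \<alpha> * norm (x - p) * (norm (?q - p))\<^sup>2"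
      using C p(1) q(1) unfolding prox_regular_def by blast
    hence "(norm (?q - p))\<^sup>2 \<le> (2 * \<alpha> * norm (x - p)) * (norm (?q - p))\<^sup>2"
      using eq by simp
    moreover have "2 * \<alpha> * norm (x - p) < 1"
      using r \<alpha> by (simp add: field_simps)
    moreover have "(norm (?q - p))\<^sup>2 > 0" using ne by simp
    ultimately show False by (simp add: mult_le_cancel_right1 not_less[symmetric])
  qed
  thus ?thesis using q by blast
qed

end

theory Submission imports Defs begin

text \<open>Let \<open>p\<close> and \<open>p + h *\<^sub>R d\<close> be nearest points of \<open>x\<close> and \<open>x + h *\<^sub>R v\<close>. Comparing the two in each
  of the two minimality conditions encloses \<open>2 * ((x - p) \<bullet> d)\<close> between two quantities of order
  \<open>h\<close>. Hence the limit of \<open>d\<close> is orthogonal to \<open>x - p\<close>.\<close>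

lemma closest_point_diff_bounds:
  fixes C :: "'a::euclidean_space set"
  assumes C: "closed C" "C \<noteq> {}" and h: "h > 0"
    and d: "d = (1 / h) *\<^sub>R (closest_point C (x + h *\<^sub>R v) - closest_point C x)"
  shows "2 * ((x - closest_point C x) \<bullet> d) \<le> h * (d \<bullet> d)"
    and "h * (d \<bullet> d) - 2 * h * (v \<bullet> d) \<le> 2 * ((x - closest_point C x) \<bullet> d)"
proof -
  define p where "p = closest_point C x"
  define z where "z = x - p"
  have q: "closest_point C (x + h *\<^sub>R v) = p + h *\<^sub>R d"
    using h by (simp add: d p_def)
  have mem: "p \<in> C" "p + h *\<^sub>R d \<in> C"
    using closest_point_in_set[OF C, of x] closest_point_in_set[OF C, of "x + h *\<^sub>R v"]
    unfolding q by (simp_all add: p_def)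
  \<comment> \<open>The nearest point \<open>p\<close> of \<open>x\<close> competes with
    \<open>p + h *\<^sub>R d\<close>. After squaring, \<open>z \<bullet> z\<close> cancels and a
    factor \<open>h > 0\<close> can be divided out.\<close>
  have "norm z \<le> norm (z - h *\<^sub>R d)"
    using closest_point_le[OF C(1) mem(2), of x] by (simp add: dist_norm z_def p_def algebra_simps)
  hence "0 \<le> h * (h * (d \<bullet> d) - 2 * (z \<bullet> d))"
    by (simp add: norm_le inner_diff inner_commute algebra_simps)
  thus "2 * ((x - closest_point C x) \<bullet> d) \<le> h * (d \<bullet> d)"
    using h by (simp add: zero_le_mult_iff z_def p_def)
  \<comment> \<open>Now the roles are swapped: \<open>p\<close> is the competitor for the perturbed
    point. Moving the base point by \<open>h *\<^sub>R v\<close> costs the extra term in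
    \<open>v \<bullet> d\<close>.\<close>
  have "norm (z + h *\<^sub>R v - h *\<^sub>R d) \<le> norm (z + h *\<^sub>R v)"
    using closest_point_le[OF C(1) mem(1), of "x + h *\<^sub>R v"]
    unfolding q by (simp add: dist_norm z_def algebra_simps)
  hence "0 \<le> h * (2 * (z \<bullet> d) - (h * (d \<bullet> d) - 2 * h * (v \<bullet> d)))"
    by (simp add: norm_le inner_diff inner_add inner_commute algebra_simps)
  thus "h * (d \<bullet> d) - 2 * h * (v \<bullet> d) \<le> 2 * ((x - closest_point C x) \<bullet> d)"
    using h by (simp add: zero_le_mult_iff z_def p_def)
qed

text \<open>Convergent difference quotients stay bounded near 0, so both enclosing bounds vanish
  with \<open>h\<close> and a squeeze applies.\<close>

lemma dir_derivative_closest_point_orthogonal: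
  fixes C :: "'a::euclidean_space set"
  assumes C: "closed C" "C \<noteq> {}" and deriv: "has_dir_derivative (closest_point C) x v w"
  shows "w \<bullet> (x - closest_point C x) = 0"
proof -
  define d where "d h = (1 / h) *\<^sub>R (closest_point C (x + h *\<^sub>R v) - closest_point C x)" for h
  define z where "z = x - closest_point C x"
  have d: "(d \<longlongrightarrow> w) (at_right 0)"
    using deriv unfolding has_dir_derivative_def d_def .
  \<comment> \<open>Both limits are 0; they are left unsimplified to match the shape that
    \<open>tendsto_intros\<close> produces.\<close>
  have upper: "((\<lambda>h. h * (d h \<bullet> d h)) \<longlongrightarrow> 0 * (w \<bullet> w)) (at_right 0)"
    and lower: "((\<lambda>h. h * (d h \<bullet> d h) - 2 * h * (v \<bullet> d h)) \<longlongrightarrow> 0 * (w \<bullet> w) - 2 * 0 * (v \<bullet> w))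
      (at_right 0)"
    by (intro tendsto_intros d)+
  have pos: "\<forall>\<^sub>F h in at_right 0. (0::real) < h"
    by (rule eventually_at_right_less)
  have "((\<lambda>h. 2 * (z \<bullet> d h)) \<longlongrightarrow> 0) (at_right 0)"
  proof (rule tendsto_sandwich)
    show "\<forall>\<^sub>F h in at_right 0. h * (d h \<bullet> d h) - 2 * h * (v \<bullet> d h) \<le> 2 * (z \<bullet> d h)"
      using pos by eventually_elim (use closest_point_diff_bounds(2)[OF C _ d_def] in \<open>simp add: z_def\<close>)
    show "\<forall>\<^sub>F h in at_right 0. 2 * (z \<bullet> d h) \<le> h * (d h \<bullet> d h)"
      using pos by eventually_elim (use closest_point_diff_bounds(1)[OF C _ d_def] in \<open>simp add: z_def\<close>)
  qed (use upper lower in simp_all)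
  moreover have "((\<lambda>h. 2 * (z \<bullet> d h)) \<longlongrightarrow> 2 * (z \<bullet> w)) (at_right 0)"
    by (intro tendsto_intros d)
  \<comment> \<open>Limits are unique because \<open>at_right 0\<close> is a nontrivial
    filter.\<close>
  ultimately have "2 * (z \<bullet> w) = 0"
    by (rule tendsto_unique[OF trivial_limit_at_right_real, rotated])
  thus ?thesis
    by (simp add: z_def inner_commute)
qed

theorem lemma7:
  fixes C :: "(real ^ 'n) set" and x v vbar :: "real ^ 'n" and \<alpha> :: real
  assumes "\<alpha> > 0"
    and "prox_regular \<alpha> C"
    and "x \<in> {c + (1 / (2 * \<alpha>)) *\<^sub>R b | c b. c \<in> C \<and> b \<in> ball 0 1}"
    and "has_dir_derivative (closest_point C) x v vbar"
  shows "vbar \<bullet> (x - closest_point C x) = 0"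
proof (rule dir_derivative_closest_point_orthogonal)
  \<comment> \<open>A closed nonempty set in finite dimension attains its distance to every point,
    so \<open>closest_point C\<close> really yields nearest points.\<close>
  show "closed C"
    using assms(2) by (simp add: prox_regular_def clarke_regular_def)
  show "C \<noteq> {}"
    using assms(3) by blast
qed (fact assms(4))

end
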